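(* Let $X\in\{A,B,D\}$ and let $w\in S^X_n$ (where $S^A_n=S_n$). Then \[ \$(w)=\frac{\operatorname{tvd}(w)}{2}+\operatorname{bl}^B(w)-\operatorname{bl}^X(w). \]
   Context: Fix a positive integer $n$, $[n]=\{1,\dots,n\}$, $\pm[n]=\{\pm1,\dots,\pm n\}$. $S^A_n=S_n$ is the group of bijections of $[n]$, regarded also as the subgroup of $S^B_n$ of elements preserving $[n]$. $S^B_n$ is the group of bijections $w$ of $\pm[n]$ with $w(-i)=-w(i)$; $S^D_n$ is the subgroup of $w\in S^B_n$ with $\#\{i\in[n]:w(i)<0\}$ even. The total displacement is $\operatorname{tvd}(w)=\sum_{i=1}^n|w(i)-i|$. Transpositions of $S^X_n$: in $S_n$, the usual transpositions $(i~j)$; in $S^B_n$, the involutions $(i~j)(-i~-j)$ for $j\ne\pm i$ and $(i~-i)$; in $S^D_n$, only the involutions $(i~j)(-i~-j)$ with $j\ne \pm i$. The cost of a transposition $t$ is $\$(t)=\operatorname{tvd}(t)/2$ (so $\$((i~j)(-i~-j))=|i-j|$, $\$((i~-i))=|i|$), and for $w\in S^X_n$, $\$(w)=\min\{\$(t_1)+\cdots+\$(t_k): t_i\text{ transpositions of } S^X_n,\ t_1\cdots t_k=w\}$ (identity has cost $0$). Blocks: every signed permutation decomposes uniquely as a direct sum of indecomposable signed permutations; equivalently, $\operatorname{bl}^B(w)$ is the number of $j\in[n]$ such that $w$ restricts to a bijection of $\pm[j]$ onto itself. $\operatorname{bl}^A(w)$ for $w\in S_n$ is the number of $j\in[n]$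 with $w([j])=[j]$ (which equals $\operatorname{bl}^B(w)$). For $w\in S^D_n$, $\operatorname{bl}^D(w)$ is the number of summands in the finest decomposition of $w$ as a direct sum of even-signed permutations, i.e., the number of $j\in[n]$ such that $w$ restricts to a bijection of $\pm[j]$ onto itself and $\#\{i\in[j]: w(i)<0\}$ is even. *)

theory Defs
  imports Complex_Main "HOL-Combinatorics.Permutations"
begin

datatype ptype = TypeA | TypeB | TypeD

definition pm :: "nat \<Rightarrow> int set" where
  "pm n = {1..int n} \<union> {- int n..-1}"

text \<open>A bijection of \<open>pm n\<close> is represented, as usual for \<open>permutes\<close>, by its extension to all of
  \<open>int\<close> that is the identity outside \<open>pm n\<close>; in particular it fixes 0.\<close>

definition signed_perms :: "nat \<Rightarrow> (int \<Rightarrow> int) set" where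
  "signed_perms n = {w. w permutes pm n \<and> (\<forall>i\<in>pm n. w (- i) = - w i)}"

definition neg_count :: "nat \<Rightarrow> (int \<Rightarrow> int) \<Rightarrow> nat" where
  "neg_count n w = card {i \<in> {1..int n}. w i < 0}"

text \<open>The symmetric group (type A) is regarded as the subgroup of the group of signed permutations
  that preserves \<open>{1..int n}\<close>: a permutation \<open>u\<close> of \<open>{1..int n}\<close> is extended by
  \<open>u (- i) = - u i\<close>.\<close>

fun perm_group :: "ptype \<Rightarrow> nat \<Rightarrow> (int \<Rightarrow> int) set" where
  "perm_group TypeA n = {w \<in> signed_perms n. w ` {1..int n} = {1..int n}}"
| "perm_group TypeB n = signed_perms n"
| "perm_group TypeD n = {w \<in> signed_perms n. even (neg_count n w)}"

definition tvd :: "nat \<Rightarrow> (int \<Rightarrow> int) \<Rightarrow> int" where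
  "tvd n w = (\<Sum>i\<in>{1..int n}. \<bar>w i - i\<bar>)"

text \<open>Under the embedding above, the usual transposition \<open>(i j)\<close> of type A becomes
  \<open>(i j)(-i -j)\<close> with \<open>i\<close>, \<open>j\<close> positive.\<close>

fun transpositions :: "ptype \<Rightarrow> nat \<Rightarrow> (int \<Rightarrow> int) set" where
  "transpositions TypeA n =
     {transpose i j \<circ> transpose (- i) (- j) | i j.
        i \<in> {1..int n} \<and> j \<in> {1..int n} \<and> i \<noteq> j}"
| "transpositions TypeB n =
     {transpose i j \<circ> transpose (- i) (- j) | i j.
        i \<in> pm n \<and> j \<in> pm n \<and> j \<noteq> i \<and> j \<noteq> - i}
     \<union> {transpose i (- i) | i. i \<in> pm n}"
| "transpositions TypeD n =
     {transpose i j \<circ> transpose (- i) (- j) | i j.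
        i \<in> pm n \<and> j \<in> pm n \<and> j \<noteq> i \<and> j \<noteq> - i}"

definition transp_cost :: "nat \<Rightarrow> (int \<Rightarrow> int) \<Rightarrow> real" where
  "transp_cost n t = real_of_int (tvd n t) / 2"

text \<open>The least element (not merely the infimum) of the set of total costs of factorizations;
  the empty factorization gives the identity cost 0.\<close>

definition cost :: "ptype \<Rightarrow> nat \<Rightarrow> (int \<Rightarrow> int) \<Rightarrow> real" where
  "cost X n w = (LEAST c. \<exists>ts. set ts \<subseteq> transpositions X n \<and> foldr (\<circ>) ts id = w
                            \<and> c = (\<Sum>t\<leftarrow>ts. transp_cost n t))"

text \<open>Each \<open>j\<close> counted below is the right end of a summand in the finest direct sum decomposition
  of \<open>w\<close> into permutations, signed permutations, or even-signed permutations, respectively.\<close>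

fun blocks :: "ptype \<Rightarrow> nat \<Rightarrow> (int \<Rightarrow> int) \<Rightarrow> nat" where
  "blocks TypeA n w = card {j \<in> {1..n}. w ` {1..int j} = {1..int j}}"
| "blocks TypeB n w = card {j \<in> {1..n}. bij_betw w (pm j) (pm j)}"
| "blocks TypeD n w = card {j \<in> {1..n}. bij_betw w (pm j) (pm j) \<and> even (neg_count j w)}"

end

(* Right multiplication by a transposition changes tvd by at most the displacement of the
   transposition, so tvd/2 bounds the cost from below; if w is not the identity, some i < j
   satisfy w i >= j and w j <= i, and swapping them attains this change. That settles types A and B.

   In type D the correction bl^B - bl^D counts the "odd cuts": the k such that w preserves pm k with
   an odd number of sign changes on {1..k}. A swap of positions a < b affects only the cuts in
   {a..<b}, and an estimate of the change of tvd shows that tvd/2 plus the number of odd cuts still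
   drops by at most the cost of the swap. Conversely, if there are odd cuts, let k be the largest
   one and y > k the next position with a negative value: for y = k + 1 the swap of k and y removes
   the cut without changing tvd by more than allowed, and otherwise y can be moved left by a
   reducing swap whose new cuts are all even. Without odd cuts, a case analysis on the first two
   positions with negative values gives a reducing swap that creates no odd cut. *)

theory Submission
  imports Defs
begin

section \<open>Signed transpositions and odd cuts\<close>

text \<open>The sign is kept apart from the positions: with \<open>0 < a < b\<close> and
  \<open>s \<in> {1, - 1}\<close> every type D transposition has this form, and \<open>s = 1\<close>
  gives those of type A. Statements about \<open>tvd\<close> and cuts then concern positive
  positions only.\<close>

definition signed_transp :: "int \<Rightarrow> int \<Rightarrow> int \<Rightarrow> int \<Rightarrow> int" where
  "signed_transp s a b = transpose (s * a) b \<circ> transpose (- (s * a)) (- b)"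

text \<open>The block ends counted in type B but not in type D. They are integers, so that they
  compare directly with positions and values of \<open>w\<close>, and the cut condition looks only
  at positive positions.\<close>

definition odd_cuts :: "nat \<Rightarrow> (int \<Rightarrow> int) \<Rightarrow> int set" where
  "odd_cuts n w = {k \<in> {1..int n}. (\<forall>i\<in>{1..k}. \<bar>w i\<bar> \<le> k) \<and> odd (card {i \<in> {1..k}. w i < 0})}"

section \<open>Values and absolute values of signed permutations\<close>

lemma mem_pm [simp]: "i \<in> pm n \<longleftrightarrow> i \<noteq> 0 \<and> \<bar>i\<bar> \<le> int n"
  by (auto simp: pm_def)

lemma finite_pm [simp]: "finite (pm n)"
  by (simp add: pm_def)

lemma signed_perms_minus:
  assumes "w \<in> signed_perms n"
  shows "w (- i) = - w i"
proof (cases "i \<in> pm n")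
  case False
  then have "w i = i" "w (- i) = - i"
    using assms permutes_not_in[of w "pm n"] by (auto simp: signed_perms_def)
  then show ?thesis by simp
qed (use assms in \<open>auto simp: signed_perms_def\<close>)

lemma signed_permsD:
  assumes "w \<in> signed_perms n"
  shows "inj w" and "w i = 0 \<longleftrightarrow> i = 0" and "i \<in> pm n \<Longrightarrow> \<bar>w i\<bar> \<le> int n"
    and "int n < \<bar>i\<bar> \<Longrightarrow> w i = i"
proof -
  have p: "w permutes pm n" using assms by (simp add: signed_perms_def)
  show inj: "inj w" using p by (rule permutes_inj)
  have "w 0 = 0" using permutes_not_in[OF p, of 0] by simp
  then show "w i = 0 \<longleftrightarrow> i = 0" using inj by (metis injD)
  show "i \<in> pm n \<Longrightarrow> \<bar>w i\<bar> \<le> int n" using permutes_in_image[OF p, of i] by simp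
  show "int n < \<bar>i\<bar> \<Longrightarrow> w i = i" using permutes_not_in[OF p, of i] by simp
qed

lemma abs_eq_signed_perm:
  assumes "w \<in> signed_perms n" and "\<bar>w i\<bar> = \<bar>w j\<bar>"
  shows "\<bar>i\<bar> = \<bar>j\<bar>"
proof -
  have "w i = w j \<or> w i = w (- j)"
    using assms signed_perms_minus[OF assms(1), of j] by linarith
  then have "i = j \<or> i = - j" using signed_permsD(1)[OF assms(1)] by (auto dest: injD)
  then show ?thesis by auto
qed

lemma inj_on_abs_signed_perm:
  assumes "w \<in> signed_perms n" and "S \<subseteq> {1..}"
  shows "inj_on (\<lambda>i. \<bar>w i\<bar>) S"
proof (rule inj_onI)
  fix x y assume "x \<in> S" "y \<in> S" "\<bar>w x\<bar> = \<bar>w y\<bar>"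
  then have "\<bar>x\<bar> = \<bar>y\<bar>" "x \<ge> 1" "y \<ge> 1"
    using abs_eq_signed_perm[OF assms(1), of x y] assms(2) by auto
  then show "x = y" by simp
qed

lemma bij_betw_abs_signed_perm:
  assumes "w \<in> signed_perms n"
  shows "bij_betw (\<lambda>i. \<bar>w i\<bar>) {1..int n} {1..int n}"
proof -
  have i: "inj_on (\<lambda>i. \<bar>w i\<bar>) {1..int n}" by (rule inj_on_abs_signed_perm[OF assms]) auto
  have "(\<lambda>i. \<bar>w i\<bar>) ` {1..int n} \<subseteq> {1..int n}"
  proof
    fix v assume "v \<in> (\<lambda>i. \<bar>w i\<bar>) ` {1..int n}"
    then obtain i where i: "i \<in> {1..int n}" "v = \<bar>w i\<bar>" by auto
    then show "v \<in> {1..int n}"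
      using signed_permsD(2,3)[OF assms, of i] by auto
  qed
  then show ?thesis
    using i endo_inj_surj[of "{1..int n}"] by (simp add: bij_betw_def)
qed

text \<open>Absolute values at distinct positive positions are distinct and positive, and only
  \<open>m - 1\<close> positive integers lie below \<open>m\<close>.\<close>

lemma signed_perm_pigeonhole:
  assumes "w \<in> signed_perms n" and "S \<subseteq> {1..}" and "finite S" and "int (card S) \<ge> m" and "m \<ge> 1"
  shows "\<exists>x\<in>S. \<bar>w x\<bar> \<ge> m"
proof (rule ccontr)
  assume "\<not> ?thesis"
  then have lt: "\<bar>w x\<bar> < m" if "x \<in> S" for x using that by force
  have "(\<lambda>i. \<bar>w i\<bar>) ` S \<subseteq> {1..m - 1}"
  proof
    fix v assume "v \<in> (\<lambda>i. \<bar>w i\<bar>) ` S"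
    then obtain x where x: "x \<in> S" "v = \<bar>w x\<bar>" by blast
    then have "x \<noteq> 0" using assms(2) by auto
    then show "v \<in> {1..m - 1}" using lt[OF x(1)] x(2) signed_permsD(2)[OF assms(1), of x] by auto
  qed
  then have "card S \<le> card {1..m - 1}"
    using card_inj_on_le inj_on_abs_signed_perm[OF assms(1,2)] by blast
  then show False using assms(4,5) by auto
qed

section \<open>Cuts and block counts\<close>

text \<open>Since \<open>w\<close> is odd, a bound on positive positions carries over to negative
  ones; an injective map of a finite set into itself is then a bijection.\<close>

lemma signed_perm_cut_iff:
  assumes "w \<in> signed_perms n"
  shows "bij_betw w (pm j) (pm j) \<longleftrightarrow> (\<forall>i\<in>{1..int j}. \<bar>w i\<bar> \<le> int j)"
proof
  assume "bij_betw w (pm j) (pm j)"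
  then have "w i \<in> pm j" if "i \<in> pm j" for i using that bij_betw_apply by fast
  then show "\<forall>i\<in>{1..int j}. \<bar>w i\<bar> \<le> int j" by auto
next
  assume *: "\<forall>i\<in>{1..int j}. \<bar>w i\<bar> \<le> int j"
  have "w ` pm j \<subseteq> pm j"
  proof
    fix v assume "v \<in> w ` pm j"
    then obtain i where i: "i \<in> pm j" "v = w i" by auto
    then have "\<bar>i\<bar> \<in> {1..int j}" by auto
    then have "\<bar>w \<bar>i\<bar>\<bar> \<le> int j" using * by blast
    moreover have "\<bar>w \<bar>i\<bar>\<bar> = \<bar>w i\<bar>" using signed_perms_minus[OF assms, of i] by (simp add: abs_if)
    ultimately show "v \<in> pm j" using i signed_permsD(2)[OF assms, of i] by auto
  qed
  moreover have "inj_on w (pm j)" using signed_permsD(1)[OF assms] inj_on_subset by blast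
  ultimately show "bij_betw w (pm j) (pm j)"
    using endo_inj_surj[of "pm j" w] by (simp add: bij_betw_def)
qed

text \<open>Cuts are split by the parity of their sign changes. This turns the correction term of
  type D into a number of odd cuts.\<close>

lemma blocks_TypeB_eq:
  assumes "w \<in> signed_perms n"
  shows "blocks TypeB n w = blocks TypeD n w + card (odd_cuts n w)"
proof -
  let ?c = "\<lambda>j. \<forall>i\<in>{1..int j}. \<bar>w i\<bar> \<le> int j"
  let ?O = "{j \<in> {1..n}. ?c j \<and> odd (neg_count j w)}"
  let ?E = "{j \<in> {1..n}. ?c j \<and> even (neg_count j w)}"
  have "odd_cuts n w = int ` ?O"
  proof
    show "odd_cuts n w \<subseteq> int ` ?O"
    proof
      fix k assume k: "k \<in> odd_cuts n w"
      then have "k = int (nat k)" "nat k \<in> ?O" by (auto simp: odd_cuts_def neg_count_def)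
      then show "k \<in> int ` ?O" by blast
    qed
  qed (auto simp: odd_cuts_def neg_count_def)
  then have "card (odd_cuts n w) = card ?O" by (simp add: card_image)
  moreover have "{j \<in> {1..n}. ?c j} = ?E \<union> ?O" by auto
  moreover have "card (?E \<union> ?O) = card ?E + card ?O" by (rule card_Un_disjoint) auto
  ultimately show ?thesis
    using signed_perm_cut_iff[OF assms] by simp
qed

text \<open>The absolute values of \<open>w\<close> always permute \<open>{1..int n}\<close>, so
  only the signs matter.\<close>

lemma TypeA_iff:
  "w \<in> perm_group TypeA n \<longleftrightarrow> w \<in> signed_perms n \<and> (\<forall>i\<in>{1..int n}. w i > 0)"
proof -
  have "w ` {1..int n} = {1..int n} \<longleftrightarrow> (\<forall>i\<in>{1..int n}. w i > 0)" if w: "w \<in> signed_perms n"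
  proof
    assume "w ` {1..int n} = {1..int n}"
    then have "w i \<in> {1..int n}" if "i \<in> {1..int n}" for i using that by blast
    then show "\<forall>i\<in>{1..int n}. w i > 0" by force
  next
    assume *: "\<forall>i\<in>{1..int n}. w i > 0"
    have "w ` {1..int n} = (\<lambda>i. \<bar>w i\<bar>) ` {1..int n}"
      by (rule image_cong) (use * in force)+
    then show "w ` {1..int n} = {1..int n}"
      using bij_betw_abs_signed_perm[OF w] by (simp add: bij_betw_def)
  qed
  then show ?thesis by auto
qed

lemma blocks_TypeA_eq:
  assumes "w \<in> perm_group TypeA n"
  shows "blocks TypeA n w = blocks TypeB n w"
proof -
  have w: "w \<in> signed_perms n" and pos: "\<And>i. i \<in> {1..int n} \<Longrightarrow> w i > 0"
    using assms TypeA_iff by auto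
  have "w ` {1..int j} = {1..int j} \<longleftrightarrow> (\<forall>i\<in>{1..int j}. \<bar>w i\<bar> \<le> int j)" if "j \<in> {1..n}" for j
  proof
    assume "w ` {1..int j} = {1..int j}"
    then have "w i \<in> {1..int j}" if "i \<in> {1..int j}" for i using that by blast
    then show "\<forall>i\<in>{1..int j}. \<bar>w i\<bar> \<le> int j" by force
  next
    assume "\<forall>i\<in>{1..int j}. \<bar>w i\<bar> \<le> int j"
    then have "w ` {1..int j} \<subseteq> {1..int j}" using pos that by fastforce
    moreover have "inj_on w {1..int j}" using signed_permsD(1)[OF w] inj_on_subset by blast
    ultimately show "w ` {1..int j} = {1..int j}" by (simp add: endo_inj_surj)
  qed
  then have "{j \<in> {1..n}. w ` {1..int j} = {1..int j}} = {j \<in> {1..n}. bij_betw w (pm j) (pm j)}"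
    by (intro Collect_cong) (auto simp only: signed_perm_cut_iff[OF w])
  then show ?thesis by simp
qed

section \<open>Transpositions as elements of the groups\<close>

lemma signed_perms_comp:
  assumes "v \<in> signed_perms n" "w \<in> signed_perms n"
  shows "v \<circ> w \<in> signed_perms n"
proof -
  have "v \<circ> w permutes pm n"
    using assms by (intro permutes_compose) (simp_all add: signed_perms_def)
  moreover have "(v \<circ> w) (- i) = - (v \<circ> w) i" for i
    by (simp add: signed_perms_minus[OF assms(1)] signed_perms_minus[OF assms(2)])
  ultimately show ?thesis by (simp add: signed_perms_def)
qed

lemma signed_transp_apply:
  assumes "s \<in> {1, - 1}" "0 < a" "a < b"
  shows "signed_transp s a b i =
    (if i = a then s * b else if i = b then s * a
     else if i = - a then - (s * b) else if i = - b then - (s * a) else i)"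
  using assms by (auto simp: signed_transp_def transpose_def)

lemma comp_signed_transp_apply:
  assumes "w \<in> signed_perms n" "s \<in> {1, - 1}" "0 < a" "a < b" "0 < i"
  shows "(w \<circ> signed_transp s a b) i = (if i = a then s * w b else if i = b then s * w a else w i)"
  using assms(2-) signed_perms_minus[OF assms(1), of a] signed_perms_minus[OF assms(1), of b]
  by (auto simp: signed_transp_apply)

lemma signed_transp_in:
  assumes "s \<in> {1, - 1}" "0 < a" "a < b" "b \<le> int n"
  shows "signed_transp s a b \<in> transpositions TypeD n"
proof -
  have "s * a \<in> pm n" "b \<in> pm n" "b \<noteq> s * a" "b \<noteq> - (s * a)" using assms by auto
  then show ?thesis unfolding signed_transp_def transpositions.simps by blast
qed

text \<open>The product \<open>(i j)(-i -j)\<close> does not change when \<open>i\<close> and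
  \<open>j\<close> are exchanged or both negated. So \<open>\<bar>i\<bar> < \<bar>j\<bar>\<close>
  and \<open>j > 0\<close> can be arranged, and the remaining sign of \<open>i\<close> becomes
  \<open>s\<close>.\<close>

lemma transpositions_TypeD_cases:
  assumes "t \<in> transpositions TypeD n"
  obtains s a b where "s \<in> {1, - 1}" "0 < a" "a < b" "b \<le> int n" "t = signed_transp s a b"
proof -
  define F where "F i j = transpose i j \<circ> transpose (- i) (- j)" for i j :: int
  have F_swap: "F i j = F j i" for i j by (simp add: F_def transpose_commute)
  have F_neg: "F (- i) (- j) = F i j" if "i \<noteq> 0" "j \<noteq> 0" "j \<noteq> i" "j \<noteq> - i" for i j
    using that by (auto simp: F_def fun_eq_iff transpose_def)
  obtain i j where ij: "i \<in> pm n" "j \<in> pm n" "j \<noteq> i" "j \<noteq> - i" "t = F i j"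
    using assms by (auto simp: F_def)
  have "\<exists>i j. i \<in> pm n \<and> j \<in> pm n \<and> \<bar>i\<bar> < \<bar>j\<bar> \<and> t = F i j"
  proof (cases "\<bar>i\<bar> < \<bar>j\<bar>")
    case True
    then show ?thesis using ij by blast
  next
    case False
    then have "\<bar>j\<bar> < \<bar>i\<bar>" using ij by linarith
    then show ?thesis using ij F_swap by metis
  qed
  then obtain i j where ij: "i \<in> pm n" "j \<in> pm n" "\<bar>i\<bar> < \<bar>j\<bar>" "t = F i j" by blast
  \<comment> \<open>Negating both indices when \<open>j < 0\<close> makes the second one
    \<open>\<bar>j\<bar>\<close> and the first one \<open>i'\<close>.\<close>
  define i' where "i' = sgn j * i"
  have i': "i' \<noteq> 0" "\<bar>i'\<bar> = \<bar>i\<bar>" using ij by (auto simp: i'_def abs_mult sgn_if)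
  have "t = F i' \<bar>j\<bar>"
  proof (cases "0 < j")
    case True
    then show ?thesis using ij by (simp add: i'_def)
  next
    case False
    then have "i' = - i" "\<bar>j\<bar> = - j" using ij by (auto simp: i'_def)
    then show ?thesis using ij F_neg[of i j] by auto
  qed
  then have "t = signed_transp (sgn i') \<bar>i'\<bar> \<bar>j\<bar>"
    by (simp add: signed_transp_def F_def sgn_mult_abs)
  moreover have "sgn i' \<in> {1, - 1}" using i' by (simp add: sgn_if)
  moreover have "0 < \<bar>i'\<bar>" "\<bar>i'\<bar> < \<bar>j\<bar>" "\<bar>j\<bar> \<le> int n" using ij i' by auto
  ultimately show thesis using that by blast
qed

lemma transposition_involution:
  assumes "t \<in> transpositions X n"
  shows "t \<circ> t = id"
proof -
  have "transpose i j \<circ> transpose (- i) (- j) \<circ> (transpose i j \<circ> transpose (- i) (- j)) = id"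
    if "i \<noteq> 0" "j \<noteq> 0" "j \<noteq> i" "j \<noteq> - i" for i j :: int
    using that by (auto simp: fun_eq_iff transpose_def)
  then show ?thesis using assms by (cases X) auto
qed

lemma transposition_signed_perm:
  assumes "t \<in> transpositions X n"
  shows "t \<in> signed_perms n"
proof -
  have 1: "transpose i j \<circ> transpose (- i) (- j) \<in> signed_perms n"
    if "i \<in> pm n" "j \<in> pm n" "j \<noteq> i" "j \<noteq> - i" for i j :: int
  proof -
    have "transpose i j \<circ> transpose (- i) (- j) permutes pm n"
      by (intro permutes_compose permutes_swap_id) (use that in auto)
    moreover have "(transpose i j \<circ> transpose (- i) (- j)) (- x)
        = - (transpose i j \<circ> transpose (- i) (- j)) x" for x
      using that by (auto simp: transpose_def)
    ultimately show ?thesis by (auto simp: signed_perms_def)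
  qed
  have 2: "transpose i (- i) \<in> signed_perms n" if "i \<in> pm n" for i
  proof -
    have "transpose i (- i) permutes pm n" by (rule permutes_swap_id) (use that in auto)
    then show ?thesis using that by (auto simp: signed_perms_def transpose_def)
  qed
  show ?thesis
  proof (cases X)
    case TypeA
    then obtain i j where "t = transpose i j \<circ> transpose (- i) (- j)"
      "i \<in> {1..int n}" "j \<in> {1..int n}" "i \<noteq> j" using assms by auto
    then show ?thesis using 1[of i j] by auto
  qed (use assms 1 2 in auto)
qed

section \<open>Effect of a signed transposition on parity, cuts and displacement\<close>

text \<open>The parity is read off the product of signs, which a signed transposition merely permutes
  up to the factor \<open>s * s = 1\<close>.\<close>

lemma even_neg_card_iff:
  fixes w :: "int \<Rightarrow> int"
  assumes "\<And>i. i \<in> {1..k} \<Longrightarrow> w i \<noteq> 0"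
  shows "even (card {i \<in> {1..k}. w i < 0}) \<longleftrightarrow> (\<Prod>i\<in>{1..k}. sgn (w i)) = 1"
proof -
  have "(\<Prod>i\<in>{1..k}. sgn (w i)) = (\<Prod>i\<in>{1..k}. if w i < 0 then - 1 else 1)"
    by (rule prod.cong) (use assms in \<open>auto simp: sgn_if\<close>)
  also have "\<dots> = (\<Prod>i\<in>{i \<in> {1..k}. w i < 0}. - 1)"
    by (rule prod.inter_filter[symmetric]) simp
  also have "\<dots> = (- 1) ^ card {i \<in> {1..k}. w i < 0}" by simp
  finally show ?thesis by (auto simp: minus_one_power_iff)
qed

lemma even_neg_card_comp:
  assumes "w \<in> signed_perms n" "s \<in> {1, - 1}" "0 < a" "a < b" "b \<le> k"
  shows "even (card {i \<in> {1..k}. (w \<circ> signed_transp s a b) i < 0})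
    \<longleftrightarrow> even (card {i \<in> {1..k}. w i < 0})"
proof -
  let ?v = "w \<circ> signed_transp s a b"
  have S: "{1..k} = insert a (insert b ({1..k} - {a, b}))" using assms by auto
  have P: "(\<Prod>i\<in>{1..k}. f i) = f a * (f b * (\<Prod>i\<in>{1..k} - {a, b}. f i))" for f :: "int \<Rightarrow> int"
    by (subst S) (use assms in simp)
  have "(\<Prod>i\<in>{1..k} - {a, b}. sgn (?v i)) = (\<Prod>i\<in>{1..k} - {a, b}. sgn (w i))"
    by (rule prod.cong) (use comp_signed_transp_apply[OF assms(1-4)] in auto)
  moreover have "sgn (?v a) * sgn (?v b) = sgn (w a) * sgn (w b)"
    using comp_signed_transp_apply[OF assms(1-4)] assms by (auto simp: sgn_mult)
  ultimately have "(\<Prod>i\<in>{1..k}. sgn (?v i)) = (\<Prod>i\<in>{1..k}. sgn (w i))"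
    unfolding P by (metis mult.assoc)
  moreover have "w i \<noteq> 0" "?v i \<noteq> 0" if "i \<in> {1..k}" for i
    using that assms(2-) comp_signed_transp_apply[OF assms(1-4), of i] signed_permsD(2)[OF assms(1)]
    by auto
  ultimately show ?thesis using even_neg_card_iff[of k w] even_neg_card_iff[of k ?v] by simp
qed

text \<open>For \<open>k < a\<close> nothing changes on \<open>{1..k}\<close>. For
  \<open>b \<le> k\<close> both positions lie in \<open>{1..k}\<close>, so the absolute values there
  are only permuted and the parity is kept.\<close>

lemma odd_cuts_comp:
  assumes "w \<in> signed_perms n" "s \<in> {1, - 1}" "0 < a" "a < b" "k \<notin> {a..<b}"
  shows "k \<in> odd_cuts n (w \<circ> signed_transp s a b) \<longleftrightarrow> k \<in> odd_cuts n w"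
proof -
  let ?v = "w \<circ> signed_transp s a b"
  note ap = comp_signed_transp_apply[OF assms(1-4)]
  show ?thesis
  proof (cases "k < a")
    case True
    then have e: "?v i = w i" if "i \<in> {1..k}" for i using ap[of i] that assms by auto
    then have "{i \<in> {1..k}. ?v i < 0} = {i \<in> {1..k}. w i < 0}" by auto
    moreover have "(\<forall>i\<in>{1..k}. \<bar>?v i\<bar> \<le> k) \<longleftrightarrow> (\<forall>i\<in>{1..k}. \<bar>w i\<bar> \<le> k)"
      using e by auto
    ultimately show ?thesis unfolding odd_cuts_def by simp
  next
    case False
    then have k: "b \<le> k" using assms by auto
    have av: "\<bar>?v a\<bar> = \<bar>w b\<bar>" "\<bar>?v b\<bar> = \<bar>w a\<bar>" "\<And>i. i > 0 \<Longrightarrow> i \<noteq> a \<Longrightarrow> i \<noteq> b \<Longrightarrow> ?v i = w i"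
      using ap assms by auto
    have ab: "a \<in> {1..k}" "b \<in> {1..k}" using k assms by auto
    have other: "\<bar>?v i\<bar> = \<bar>w i\<bar>" if "i \<in> {1..k}" "i \<noteq> a" "i \<noteq> b" for i
      using av(3)[of i] that by simp
    have "(\<forall>i\<in>{1..k}. \<bar>?v i\<bar> \<le> k) \<longleftrightarrow> (\<forall>i\<in>{1..k}. \<bar>w i\<bar> \<le> k)"
    proof (intro iffI ballI)
      fix i assume *: "\<forall>i\<in>{1..k}. \<bar>?v i\<bar> \<le> k" and i: "i \<in> {1..k}"
      consider "i = a" | "i = b" | "i \<noteq> a" "i \<noteq> b" by blast
      then show "\<bar>w i\<bar> \<le> k" using * i ab av(1,2) other by cases metis+
    next
      fix i assume *: "\<forall>i\<in>{1..k}. \<bar>w i\<bar> \<le> k" and i: "i \<in> {1..k}"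
      consider "i = a" | "i = b" | "i \<noteq> a" "i \<noteq> b" by blast
      then show "\<bar>?v i\<bar> \<le> k" using * i ab av(1,2) other by cases metis+
    qed
    then show ?thesis
      using even_neg_card_comp[OF assms(1-4) k] unfolding odd_cuts_def by simp
  qed
qed

lemma tvd_comp:
  assumes "w \<in> signed_perms n" "s \<in> {1, - 1}" "0 < a" "a < b" "b \<le> int n"
  shows "tvd n (w \<circ> signed_transp s a b)
    = tvd n w - \<bar>w a - a\<bar> - \<bar>w b - b\<bar> + \<bar>s * w b - a\<bar> + \<bar>s * w a - b\<bar>"
proof -
  let ?v = "w \<circ> signed_transp s a b"
  let ?S = "{1..int n} - {a, b}"
  have S: "{1..int n} = insert a (insert b ?S)" using assms by auto
  have P: "(\<Sum>i\<in>{1..int n}. f i) = f a + (f b + (\<Sum>i\<in>?S. f i))" for f :: "int \<Rightarrow> int"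
    by (subst S) (use assms in simp)
  have "(\<Sum>i\<in>?S. \<bar>?v i - i\<bar>) = (\<Sum>i\<in>?S. \<bar>w i - i\<bar>)"
    by (rule sum.cong) (use comp_signed_transp_apply[OF assms(1-4)] in auto)
  moreover have "?v a = s * w b" "?v b = s * w a"
    using comp_signed_transp_apply[OF assms(1-4)] assms by auto
  ultimately show ?thesis unfolding tvd_def P by simp
qed

lemma id_signed_perms: "id \<in> signed_perms n"
  by (simp add: signed_perms_def permutes_id)

lemma tvd_id [simp]: "tvd n id = 0"
  by (simp add: tvd_def)

text \<open>One formula for both costs: half of it is \<open>b - a\<close> for \<open>s = 1\<close>
  and \<open>b + a\<close> for \<open>s = - 1\<close>.\<close>

lemma tvd_signed_transp:
  assumes "s \<in> {1, - 1}" "0 < a" "a < b" "b \<le> int n"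
  shows "tvd n (signed_transp s a b) = 2 * (b - s * a)"
  using tvd_comp[OF id_signed_perms assms] assms by auto

text \<open>Insert \<open>t i\<close> between \<open>v (t i)\<close> and \<open>i\<close>. The
  displacement of \<open>v\<close> is the same at \<open>x\<close> and \<open>- x\<close>, and
  \<open>\<bar>t i\<bar>\<close> runs through \<open>{1..int n}\<close>, so the first parts add up
  to \<open>tvd n v\<close>.\<close>

lemma tvd_triangle:
  assumes "v \<in> signed_perms n" "t \<in> signed_perms n"
  shows "tvd n (v \<circ> t) \<le> tvd n v + tvd n t"
proof -
  have "(\<Sum>i\<in>{1..int n}. \<bar>v (t i) - t i\<bar>) = (\<Sum>i\<in>{1..int n}. \<bar>v \<bar>t i\<bar> - \<bar>t i\<bar>\<bar>)"
  proof (rule sum.cong)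
    fix i show "\<bar>v (t i) - t i\<bar> = \<bar>v \<bar>t i\<bar> - \<bar>t i\<bar>\<bar>"
      using signed_perms_minus[OF assms(1), of "t i"] by (cases "t i \<ge> 0") auto
  qed simp
  also have "\<dots> = tvd n v"
    unfolding tvd_def
    using sum.reindex_bij_betw[OF bij_betw_abs_signed_perm[OF assms(2)], of "\<lambda>i. \<bar>v i - i\<bar>"] .
  finally have "tvd n v + tvd n t = (\<Sum>i\<in>{1..int n}. \<bar>v (t i) - t i\<bar> + \<bar>t i - i\<bar>)"
    by (simp add: tvd_def sum.distrib)
  also have "\<dots> \<ge> tvd n (v \<circ> t)"
    unfolding tvd_def by (rule sum_mono) auto
  finally show ?thesis .
qed

lemma tvd_eq_0_iff:
  assumes "w \<in> signed_perms n"
  shows "tvd n w = 0 \<longleftrightarrow> w = id"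
proof
  assume "tvd n w = 0"
  then have *: "w i = i" if "i \<in> {1..int n}" for i
    using that by (simp add: tvd_def sum_nonneg_eq_0_iff)
  have "w i = i" for i
  proof -
    have "\<bar>i\<bar> \<in> {1..int n} \<or> i = 0 \<or> int n < \<bar>i\<bar>" by auto
    then show ?thesis
      using *[of "\<bar>i\<bar>"] signed_perms_minus[OF assms, of i] signed_permsD(2,4)[OF assms, of i]
      by (auto simp: abs_if split: if_splits)
  qed
  then show "w = id" by auto
qed simp

lemma tvd_nonneg: "tvd n w \<ge> 0"
  by (simp add: tvd_def sum_nonneg)

lemma tvd_transposition_pos:
  assumes "t \<in> transpositions X n"
  shows "tvd n t > 0"
proof -
  have "t \<noteq> id"
  proof
    assume "t = id"
    then have t: "t i = i" for i by simp
    have "\<exists>i. t i \<noteq> i"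
    proof (cases X)
      case TypeA
      then obtain i j where ij: "t = transpose i j \<circ> transpose (- i) (- j)"
        "i \<in> {1..int n}" "j \<in> {1..int n}" "i \<noteq> j" using assms by auto
      then have "t i \<noteq> i" by (auto simp: transpose_def)
      then show ?thesis by blast
    next
      case TypeB
      then consider i j where "t = transpose i j \<circ> transpose (- i) (- j)" "i \<in> pm n" "j \<noteq> i" "j \<noteq> - i"
        | i where "t = transpose i (- i)" "i \<in> pm n" using assms by auto
      then show ?thesis
      proof cases
        case (1 i j)
        then have "t i \<noteq> i" by (auto simp: transpose_def)
        then show ?thesis by blast
      next
        case (2 i)
        then have "t i \<noteq> i" by (auto simp: transpose_def)
        then show ?thesis by blast
      qed
    next
      case TypeD
      then obtain i j where ij: "t = transpose i j \<circ> transpose (- i) (- j)" "i \<in> pm n" "j \<noteq> i" "j \<noteq> - i"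
        using assms by auto
      then have "t i \<noteq> i" by (auto simp: transpose_def)
      then show ?thesis by blast
    qed
    then show False using t by blast
  qed
  then show ?thesis
    using tvd_eq_0_iff[OF transposition_signed_perm[OF assms]] tvd_nonneg[of n t] by auto
qed

lemma transposition_in_group:
  assumes "w \<in> perm_group X n" "t \<in> transpositions X n"
  shows "w \<circ> t \<in> perm_group X n"
proof -
  have w: "w \<in> signed_perms n" using assms(1) by (cases X) auto
  have wt: "w \<circ> t \<in> signed_perms n"
    by (rule signed_perms_comp[OF w transposition_signed_perm[OF assms(2)]])
  show ?thesis
  proof (cases X)
    case TypeA
    then obtain i j where ij: "t = transpose i j \<circ> transpose (- i) (- j)"
        "i \<in> {1..int n}" "j \<in> {1..int n}" "i \<noteq> j" using assms by auto
    have "t x \<in> {1..int n}" if "x \<in> {1..int n}" for x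
      using ij that by (auto simp: transpose_def)
    then have "\<forall>x\<in>{1..int n}. (w \<circ> t) x > 0"
      using assms(1) TypeA TypeA_iff[of w n] by (simp del: perm_group.simps)
    then show ?thesis using wt TypeA TypeA_iff by blast
  next
    case TypeD
    then obtain s a b where *: "s \<in> {1, - 1}" "0 < a" "a < b" "b \<le> int n" "t = signed_transp s a b"
      using assms(2) transpositions_TypeD_cases by blast
    show ?thesis
      using even_neg_card_comp[OF w *(1-4)] assms(1) wt TypeD *(5) by (simp add: neg_count_def)
  qed (use wt in simp)
qed

lemma id_in_group: "id \<in> perm_group X n"
proof -
  have "{i \<in> {1..int n}. id i < 0} = {}" by auto
  then have "even (neg_count n id)" unfolding neg_count_def by (simp only: card.empty even_zero)
  then show ?thesis by (cases X) (simp_all add: id_signed_perms)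
qed

section \<open>Computing the cost from a potential\<close>

text \<open>\<open>G\<close> is a potential for twice the cost. No transposition lowers it by more
  than its own \<open>tvd\<close>, which bounds every factorization from below; away from
  \<open>id\<close> some transposition lowers it by at least that much, so descent yields a
  factorization meeting the bound.\<close>

lemma cost_eqI:
  fixes G :: "(int \<Rightarrow> int) \<Rightarrow> int"
  assumes w: "w \<in> perm_group X n"
    and id: "G id = 0"
    and nonneg: "\<And>v. G v \<ge> 0"
    and lower: "\<And>v t. v \<in> perm_group X n \<Longrightarrow> t \<in> transpositions X n \<Longrightarrow> G v \<le> G (v \<circ> t) + tvd n t"
    and upper: "\<And>v. v \<in> perm_group X n \<Longrightarrow> v \<noteq> id \<Longrightarrow>
      \<exists>t\<in>transpositions X n. G (v \<circ> t) + tvd n t \<le> G v"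
  shows "cost X n w = real_of_int (G w) / 2"
proof -
  let ?c = "\<lambda>ts. \<Sum>t\<leftarrow>ts. transp_cost n t"
  have foldr_snoc: "foldr (\<circ>) (ts @ [t]) id = foldr (\<circ>) ts id \<circ> t" for ts and t :: "int \<Rightarrow> int"
    by (induction ts) (auto simp: comp_assoc)
  \<comment> \<open>Induction from the right end of the list, because \<open>lower\<close> concerns
    multiplication on the right.\<close>
  have lb: "foldr (\<circ>) ts id \<in> perm_group X n \<and> real_of_int (G (foldr (\<circ>) ts id)) / 2 \<le> ?c ts"
    if "set ts \<subseteq> transpositions X n" for ts
    using that
  proof (induction ts rule: rev_induct)
    case Nil
    then show ?case using id id_in_group by (simp add: id_def)
  next
    case (snoc t ts)
    let ?v = "foldr (\<circ>) ts id"
    have t: "t \<in> transpositions X n" and v: "?v \<in> perm_group X n"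
      and IH: "real_of_int (G ?v) / 2 \<le> ?c ts"
    proof -
      have "set ts \<subseteq> transpositions X n" "t \<in> transpositions X n" using snoc.prems by auto
      with snoc.IH show "t \<in> transpositions X n" "?v \<in> perm_group X n"
        "real_of_int (G ?v) / 2 \<le> ?c ts" by blast+
    qed
    \<comment> \<open>\<open>lower\<close> is applied to the longer product; multiplying by
      \<open>t\<close> again leads back to \<open>?v\<close>.\<close>
    have "G (?v \<circ> t) \<le> G (?v \<circ> t \<circ> t) + tvd n t"
      by (rule lower[OF transposition_in_group[OF v t] t])
    then have "G (?v \<circ> t) \<le> G ?v + tvd n t"
      using transposition_involution[OF t] by (simp add: comp_assoc)
    moreover have "?c (ts @ [t]) = ?c ts + real_of_int (tvd n t) / 2" by (simp add: transp_cost_def)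
    ultimately show ?case
      unfolding foldr_snoc using IH transposition_in_group[OF v t] by linarith
  qed
  have ub: "\<exists>ts. set ts \<subseteq> transpositions X n \<and> foldr (\<circ>) ts id = v \<and> ?c ts \<le> real_of_int (G v) / 2"
    if "v \<in> perm_group X n" for v
    using that
  proof (induction "nat (G v)" arbitrary: v rule: less_induct)
    case less
    show ?case
    proof (cases "v = id")
      case True
      then show ?thesis using id by (intro exI[of _ "[]"]) auto
    next
      case False
      then obtain t where t: "t \<in> transpositions X n" "G (v \<circ> t) + tvd n t \<le> G v"
        using upper less.prems by blast
      have vt: "v \<circ> t \<in> perm_group X n" by (rule transposition_in_group[OF less.prems t(1)])
      \<comment> \<open>The descent is strict because every transposition has positive
        displacement.\<close>
      have "nat (G (v \<circ> t)) < nat (G v)"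
        using t(2) tvd_transposition_pos[OF t(1)] nonneg[of "v \<circ> t"] by linarith
      then obtain ts where ts: "set ts \<subseteq> transpositions X n" "foldr (\<circ>) ts id = v \<circ> t"
        "?c ts \<le> real_of_int (G (v \<circ> t)) / 2"
        using less.hyps vt by blast
      have "foldr (\<circ>) (ts @ [t]) id = v"
        using transposition_involution[OF t(1)] unfolding foldr_snoc ts(2) by (simp add: comp_assoc)
      moreover have "?c (ts @ [t]) \<le> real_of_int (G v) / 2"
        using ts(3) t(2) by (simp add: transp_cost_def)
      ultimately show ?thesis using ts(1) t(1) by (intro exI[of _ "ts @ [t]"]) auto
    qed
  qed
  obtain ts where ts: "set ts \<subseteq> transpositions X n" "foldr (\<circ>) ts id = w"
    "?c ts \<le> real_of_int (G w) / 2" using ub[OF w] by blast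
  then have eq: "?c ts = real_of_int (G w) / 2" using lb[OF ts(1)] by auto
  show ?thesis
    unfolding cost_def
  proof (rule Least_equality)
    show "\<exists>ts. set ts \<subseteq> transpositions X n \<and> foldr (\<circ>) ts id = w
        \<and> real_of_int (G w) / 2 = ?c ts"
      using ts eq by metis
  next
    fix y assume "\<exists>ts. set ts \<subseteq> transpositions X n \<and> foldr (\<circ>) ts id = w \<and> y = ?c ts"
    then show "real_of_int (G w) / 2 \<le> y" using lb by auto
  qed
qed

section \<open>Swaps that reduce the displacement\<close>

text \<open>The largest excedance \<open>i\<close> has a partner \<open>j \<in> {i<..w i}\<close> with \<open>w j \<le> i\<close>: otherwise \<open>w\<close> would
  map \<open>{i<..w i}\<close> into itself and \<open>w i\<close> would be hit twice.\<close>

lemma ex_inversion_pair: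
  assumes w: "w \<in> signed_perms n" and "w \<noteq> id"
  obtains i j where "i \<in> pm n" "j \<in> pm n" "i < j" "j \<le> w i" "w j \<le> i"
proof -
  let ?S = "{i. w i > i}"
  have sub: "?S \<subseteq> pm n"
  proof
    fix i assume "i \<in> ?S"
    then show "i \<in> pm n" using signed_permsD(2,4)[OF w, of i] by force
  qed
  then have fin: "finite ?S" using finite_subset finite_pm by blast
  obtain x where "w x \<noteq> x" using assms(2) by (auto simp: fun_eq_iff)
  then have "x \<in> ?S \<or> - x \<in> ?S" using signed_perms_minus[OF w, of x] by auto
  then have ne: "?S \<noteq> {}" by blast
  define i where "i = Max ?S"
  have i: "i \<in> ?S" unfolding i_def by (rule Max_in[OF fin ne])
  have ge: "w j \<le> j" if "i < j" for j
  proof (rule ccontr)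
    assume "\<not> ?thesis"
    then have "j \<le> i" unfolding i_def by (intro Max_ge[OF fin]) simp
    then show False using that by simp
  qed
  have "\<exists>j\<in>{i<..w i}. w j \<le> i"
  proof (rule ccontr)
    assume *: "\<not> ?thesis"
    have "w ` {i<..w i} \<subseteq> {i<..w i}"
    proof
      fix v assume "v \<in> w ` {i<..w i}"
      then obtain j where j: "j \<in> {i<..w i}" "v = w j" by blast
      then show "v \<in> {i<..w i}" using * ge[of j] by force
    qed
    moreover have "inj_on w {i<..w i}" using signed_permsD(1)[OF w] inj_on_subset by blast
    ultimately have "w ` {i<..w i} = {i<..w i}" by (simp add: endo_inj_surj)
    moreover have "w i \<in> {i<..w i}" using i by simp
    ultimately obtain j where "j \<in> {i<..w i}" "w i = w j" by (metis imageE)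
    then show False using signed_permsD(1)[OF w] by (auto dest: injD)
  qed
  then obtain j where j: "j \<in> {i<..w i}" "w j \<le> i" by blast
  \<comment> \<open>From \<open>w j \<le> i < j\<close>, the point \<open>- j\<close> is itself an
    excedance, and excedances lie in \<open>pm n\<close>.\<close>
  have "w (- j) > - j" using j signed_perms_minus[OF w, of j] by auto
  then have "- j \<in> pm n" using sub by blast
  then have "j \<in> pm n" by simp
  moreover have "i \<in> pm n" using i sub by blast
  ultimately show thesis using that[of i j] j by auto
qed

text \<open>The pair from \<open>ex_inversion_pair\<close> is rewritten in positive positions by
  oddness of \<open>w\<close>.\<close>

lemma ex_reducing_pair:
  assumes w: "w \<in> signed_perms n" and "w \<noteq> id"
  shows "(\<exists>a. 0 < a \<and> a \<le> int n \<and> w a \<le> - a) \<or>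
    (\<exists>s a b. s \<in> {1, - 1} \<and> 0 < a \<and> a < b \<and> b \<le> int n \<and> b \<le> s * w a \<and> w b \<le> s * a)"
proof -
  obtain i j where ij: "i \<in> pm n" "j \<in> pm n" "i < j" "j \<le> w i" "w j \<le> i"
    using ex_inversion_pair[OF assms] .
  note m = signed_perms_minus[OF w, of i] signed_perms_minus[OF w, of j]
  \<comment> \<open>Opposite points give a sign change at \<open>j\<close>, equal signs give
    \<open>s = 1\<close>, and different signs give \<open>s = - 1\<close> with the smaller absolute
    value as \<open>a\<close>.\<close>
  consider "j = - i" | "0 < i" | "j < 0" | "i < 0" "0 < j" "- i < j" | "i < 0" "0 < j" "j < - i"
    using ij by fastforce
  then show ?thesis
  proof cases
    case 1
    then have "0 < j" "j \<le> int n" "w j \<le> - j" using ij by auto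
    then show ?thesis by blast
  next
    case 2
    then have "(1::int) \<in> {1, - 1}" "0 < i" "i < j" "j \<le> int n" "j \<le> 1 * w i" "w j \<le> 1 * i"
      using ij by auto
    then show ?thesis by blast
  next
    case 3
    then have "(1::int) \<in> {1, - 1}" "0 < - j" "- j < - i" "- i \<le> int n" "- i \<le> 1 * w (- j)"
      "w (- i) \<le> 1 * - j" using ij m by auto
    then show ?thesis by blast
  next
    case 4
    then have "(- 1::int) \<in> {1, - 1}" "0 < - i" "- i < j" "j \<le> int n" "j \<le> - 1 * w (- i)"
      "w j \<le> - 1 * - i" using ij m by auto
    then show ?thesis by blast
  next
    case 5
    then have "(- 1::int) \<in> {1, - 1}" "0 < j" "j < - i" "- i \<le> int n" "- i \<le> - 1 * w j"
      "w (- i) \<le> - 1 * j" using ij m by auto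
    then show ?thesis by blast
  qed
qed

text \<open>The two bounds fix the sign inside each of the four absolute values of
  \<open>tvd_comp\<close>, and the drop is exactly \<open>2 * (b - s * a)\<close>.\<close>

lemma tvd_reduce:
  assumes "w \<in> signed_perms n" "s \<in> {1, - 1}" "0 < a" "a < b" "b \<le> int n"
    and "b \<le> s * w a" "w b \<le> s * a"
  shows "tvd n (w \<circ> signed_transp s a b) + tvd n (signed_transp s a b) \<le> tvd n w"
  using assms(2-) unfolding tvd_comp[OF assms(1-5)] tvd_signed_transp[OF assms(2-5)] by auto

lemma tvd_reduce_neg:
  assumes w: "w \<in> signed_perms n" and a: "0 < a" "a \<le> int n" "w a \<le> - a"
  shows "tvd n (w \<circ> transpose a (- a)) + tvd n (transpose a (- a)) \<le> tvd n w"
proof -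
  have P: "(\<Sum>i\<in>{1..int n}. f i) = f a + (\<Sum>i\<in>{1..int n} - {a}. f i)" for f :: "int \<Rightarrow> int"
    by (rule sum.remove) (use a in auto)
  have *: "transpose a (- a) i = i" if "i \<in> {1..int n} - {a}" for i
    using that a by (auto simp: transpose_def)
  have "(\<Sum>i\<in>{1..int n} - {a}. \<bar>(w \<circ> transpose a (- a)) i - i\<bar>) = (\<Sum>i\<in>{1..int n} - {a}. \<bar>w i - i\<bar>)"
    by (rule sum.cong) (use * in auto)
  moreover have "(\<Sum>i\<in>{1..int n} - {a}. \<bar>transpose a (- a) i - i\<bar>) = 0"
    by (rule sum.neutral) (use * in auto)
  ultimately show ?thesis
    unfolding tvd_def P using a signed_perms_minus[OF w, of a] by simp
qed

section \<open>Odd cuts and the lower bound in type D\<close>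

lemma finite_odd_cuts [simp]: "finite (odd_cuts n w)"
  by (rule finite_subset[of _ "{1..int n}"]) (auto simp: odd_cuts_def)

lemma not_odd_cut_no_neg: "{i \<in> {1..k}. w i < 0} = {} \<Longrightarrow> k \<notin> odd_cuts n w"
  unfolding odd_cuts_def by (simp only: mem_Collect_eq card.empty) simp

lemma not_odd_cut_witness:
  assumes "0 < i" "i \<le> k" "k < \<bar>w i\<bar>"
  shows "k \<notin> odd_cuts n w"
proof
  assume "k \<in> odd_cuts n w"
  then have "\<bar>w i\<bar> \<le> k" using assms by (auto simp: odd_cuts_def)
  then show False using assms by simp
qed

text \<open>The positions up to \<open>k\<close> already use up all absolute values up to
  \<open>k\<close>.\<close>

lemma signed_perm_cut_lt:
  assumes w: "w \<in> signed_perms n" and cut: "\<forall>i\<in>{1..k}. \<bar>w i\<bar> \<le> k" and k: "0 \<le> k" "k < b"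
  shows "k < \<bar>w b\<bar>"
proof -
  have "int (card ({1..k} \<union> {b})) \<ge> k + 1" using k by simp
  then have "\<exists>x\<in>{1..k} \<union> {b}. \<bar>w x\<bar> \<ge> k + 1"
    by (intro signed_perm_pigeonhole[OF w]) (use k in auto)
  then show ?thesis using cut by force
qed

text \<open>A signed transposition of \<open>a < b\<close> can destroy the odd cuts in \<open>{a..<b}\<close> only, and these lie
  between \<open>max a \<bar>w a\<bar>\<close> and \<open>min b \<bar>w b\<bar>\<close>.\<close>

lemma odd_cuts_lower:
  assumes w: "w \<in> signed_perms n" and s: "s \<in> {1, - 1}" and ab: "0 < a" "a < b" "b \<le> int n"
  shows "tvd n w + 2 * int (card (odd_cuts n w)) \<le>
    tvd n (w \<circ> signed_transp s a b) + 2 * int (card (odd_cuts n (w \<circ> signed_transp s a b)))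
    + tvd n (signed_transp s a b)"
proof -
  let ?v = "w \<circ> signed_transp s a b"
  define L where "L = odd_cuts n w \<inter> {a..<b}"
  have "odd_cuts n w \<subseteq> odd_cuts n ?v \<union> L"
    using odd_cuts_comp[OF w s ab(1,2)] unfolding L_def by blast
  then have "card (odd_cuts n w) \<le> card (odd_cuts n ?v \<union> L)"
    by (intro card_mono) (auto simp: L_def)
  also have "\<dots> \<le> card (odd_cuts n ?v) + card L" by (rule card_Un_le)
  finally have 1: "card (odd_cuts n w) \<le> card (odd_cuts n ?v) + card L" .
  have "L \<subseteq> {max a \<bar>w a\<bar>..<min b \<bar>w b\<bar>}"
  proof
    fix k assume k: "k \<in> L"
    then have "\<forall>i\<in>{1..k}. \<bar>w i\<bar> \<le> k" "a \<le> k" "k < b" by (auto simp: L_def odd_cuts_def)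
    moreover have "\<bar>w a\<bar> \<le> k" using calculation ab by auto
    moreover have "k < \<bar>w b\<bar>" using signed_perm_cut_lt[OF w] calculation ab by auto
    ultimately show "k \<in> {max a \<bar>w a\<bar>..<min b \<bar>w b\<bar>}" by auto
  qed
  then have "card L \<le> card {max a \<bar>w a\<bar>..<min b \<bar>w b\<bar>}" by (intro card_mono) auto
  then have L: "int (card L) \<le> max 0 (min b \<bar>w b\<bar> - max a \<bar>w a\<bar>)"
    unfolding card_atLeastLessThan_int by linarith
  \<comment> \<open>The slack in the triangle bound pays for the lost cuts:
    \<open>2 * (b - s * a)\<close> exceeds the drop in \<open>tvd\<close> by at least twice the gap
    between \<open>max a \<bar>w a\<bar>\<close> and \<open>min b \<bar>w b\<bar>\<close>, whenever
    this gap is positive.\<close>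
  have "\<bar>w a - a\<bar> + \<bar>w b - b\<bar> + 2 * int (card L) \<le> \<bar>s * w b - a\<bar> + \<bar>s * w a - b\<bar> + 2 * (b - s * a)"
  proof (cases "s = 1")
    case True
    then show ?thesis using L ab by simp (smt (verit))
  next
    case False
    then have "s = - 1" using s by simp
    then show ?thesis using L ab by simp (smt (verit))
  qed
  then show ?thesis
    unfolding tvd_comp[OF w s ab] tvd_signed_transp[OF s ab] using 1 by linarith
qed

section \<open>Reducing swaps in type D\<close>

text \<open>Outside \<open>{a..<b}\<close> odd cuts are unaffected, so a reducing swap suffices as
  soon as it creates none inside.\<close>

lemma odd_cuts_reduce:
  assumes "w \<in> signed_perms n" "s \<in> {1, - 1}" "0 < a" "a < b" "b \<le> int n"
    and "b \<le> s * w a" "w b \<le> s * a"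
    and new: "\<And>k. a \<le> k \<Longrightarrow> k < b \<Longrightarrow> k \<notin> odd_cuts n (w \<circ> signed_transp s a b)"
  shows "\<exists>t\<in>transpositions TypeD n. tvd n (w \<circ> t) + 2 * int (card (odd_cuts n (w \<circ> t))) + tvd n t
    \<le> tvd n w + 2 * int (card (odd_cuts n w))"
proof
  have "odd_cuts n (w \<circ> signed_transp s a b) \<subseteq> odd_cuts n w"
  proof
    fix k assume k: "k \<in> odd_cuts n (w \<circ> signed_transp s a b)"
    then have "k \<notin> {a..<b}" using new by auto
    then show "k \<in> odd_cuts n w" using odd_cuts_comp[OF assms(1-4)] k by blast
  qed
  then have "card (odd_cuts n (w \<circ> signed_transp s a b)) \<le> card (odd_cuts n w)"
    by (intro card_mono) auto
  then show "tvd n (w \<circ> signed_transp s a b) + 2 * int (card (odd_cuts n (w \<circ> signed_transp s a b)))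
      + tvd n (signed_transp s a b) \<le> tvd n w + 2 * int (card (odd_cuts n w))"
    using tvd_reduce[OF assms(1-7)] by linarith
qed (rule signed_transp_in[OF assms(2-5)])

text \<open>The negative value moves from \<open>b\<close> into the initial segment. This flips the
  parity, so a segment with an odd count cannot end in an odd cut afterwards.\<close>

lemma neg_card_comp:
  assumes w: "w \<in> signed_perms n" and ab: "0 < a" "a < b" "w a > 0" "w b < 0" "a \<le> k" "k < b"
  shows "card {i \<in> {1..k}. (w \<circ> signed_transp 1 a b) i < 0} = Suc (card {i \<in> {1..k}. w i < 0})"
proof -
  have ap: "(w \<circ> signed_transp 1 a b) i = (if i = a then w b else w i)" if "i \<in> {1..k}" for i
    using comp_signed_transp_apply[OF w _ ab(1,2), of 1 i] that ab by simp
  have "i \<in> {1..k} \<and> (w \<circ> signed_transp 1 a b) i < 0 \<longleftrightarrow> i \<in> insert a {i \<in> {1..k}. w i < 0}" for i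
    using ap[of i] ab by (cases "i \<in> {1..k}") (auto simp del: comp_apply)
  then have "{i \<in> {1..k}. (w \<circ> signed_transp 1 a b) i < 0} = insert a {i \<in> {1..k}. w i < 0}"
    by blast
  moreover have "finite {i \<in> {1..k}. w i < 0}" by (rule finite_subset[of _ "{1..k}"]) auto
  ultimately show ?thesis using ab by (simp del: comp_apply)
qed

lemma finite_least_element:
  fixes S :: "'a :: linorder set"
  assumes "finite S" "S \<noteq> {}"
  obtains m where "m \<in> S" "\<And>x. x \<in> S \<Longrightarrow> m \<le> x"
  using assms Min_in Min_le by metis

lemma odd_cuts_upper_nonempty:
  assumes w: "w \<in> signed_perms n" and even_n: "even (card {i \<in> {1..int n}. w i < 0})"
    and ne: "odd_cuts n w \<noteq> {}"
  shows "\<exists>t\<in>transpositions TypeD n. tvd n (w \<circ> t) + 2 * int (card (odd_cuts n (w \<circ> t))) + tvd n t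
    \<le> tvd n w + 2 * int (card (odd_cuts n w))"
proof -
  let ?N = "\<lambda>k. {i \<in> {1..k}. w i < 0}"
  define k where "k = Max (odd_cuts n w)"
  have k: "k \<in> odd_cuts n w" unfolding k_def by (rule Max_in) (use ne in auto)
  have kmax: "l \<notin> odd_cuts n w" if "k < l" for l
    using that Max_ge[OF finite_odd_cuts, of l n w] unfolding k_def by fastforce
  have k1: "1 \<le> k" "k \<le> int n" "odd (card (?N k))" and cut: "\<forall>i\<in>{1..k}. \<bar>w i\<bar> \<le> k"
    using k by (auto simp: odd_cuts_def)
  \<comment> \<open>The count is odd at \<open>k\<close> but even at \<open>n\<close>.\<close>
  have "{i \<in> {k+1..int n}. w i < 0} \<noteq> {}"
  proof
    assume *: "{i \<in> {k+1..int n}. w i < 0} = {}"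
    have "?N (int n) = ?N k"
    proof
      show "?N (int n) \<subseteq> ?N k"
      proof
        fix i assume i: "i \<in> ?N (int n)"
        then have "\<not> k < i" using * by auto
        then show "i \<in> ?N k" using i by auto
      qed
    qed (use k1 in auto)
    then show False using even_n k1 by simp
  qed
  moreover have "finite {i \<in> {k+1..int n}. w i < 0}"
    by (rule finite_subset[of _ "{k+1..int n}"]) auto
  ultimately obtain y where y: "y \<in> {i \<in> {k+1..int n}. w i < 0}"
    and ymin: "\<And>x. x \<in> {i \<in> {k+1..int n}. w i < 0} \<Longrightarrow> y \<le> x"
    using finite_least_element by blast
  have y1: "k < y" "y \<le> int n" "w y < 0" using y by auto
  have pos: "0 < w i" if "k < i" "i < y" for i
  proof -
    have "\<not> w i < 0" using ymin[of i] that y1 by auto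
    then show ?thesis using signed_permsD(2)[OF w, of i] that k1 by auto
  qed
  have N: "?N l = ?N k" if "k \<le> l" "l < y" for l
  proof
    show "?N l \<subseteq> ?N k"
    proof
      fix i assume i: "i \<in> ?N l"
      then have "\<not> k < i" using pos[of i] that by auto
      then show "i \<in> ?N k" using i by auto
    qed
  qed (use that in auto)
  show ?thesis
  proof (cases "y = k + 1")
    case True
    let ?t = "signed_transp 1 k y"
    have c: "1 \<in> {1, - 1 :: int}" "0 < k" "k < y" "y \<le> int n" using k1 y1 by auto
    have "\<bar>w k\<bar> \<le> k" using cut k1 by auto
    \<comment> \<open>The swap leaves \<open>tvd\<close> unchanged and has displacement 2, which the
      loss of the cut \<open>k\<close> compensates.\<close>
    then have tvd: "tvd n (w \<circ> ?t) + tvd n ?t \<le> tvd n w + 2"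
      unfolding tvd_comp[OF w c] tvd_signed_transp[OF c] using True y1 k1 by auto
    have "k < \<bar>(w \<circ> ?t) k\<bar>"
      using comp_signed_transp_apply[OF w c(1-3), of k] signed_perm_cut_lt[OF w cut _ y1(1)] k1
      by simp
    then have "k \<notin> odd_cuts n (w \<circ> ?t)" using k1 by (intro not_odd_cut_witness) auto
    moreover have "l \<in> odd_cuts n (w \<circ> ?t) \<longleftrightarrow> l \<in> odd_cuts n w" if "l \<noteq> k" for l
      using odd_cuts_comp[OF w c(1-3), of l] True that by auto
    ultimately have "l \<in> odd_cuts n (w \<circ> ?t) \<longleftrightarrow> l \<in> odd_cuts n w - {k}" for l
      by (cases "l = k") simp_all
    then have "odd_cuts n (w \<circ> ?t) = odd_cuts n w - {k}" by blast
    then have "card (odd_cuts n w) = Suc (card (odd_cuts n (w \<circ> ?t)))"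
      using k by (metis card.remove finite_odd_cuts)
    then show ?thesis using tvd signed_transp_in[OF c] by (intro bexI[of _ ?t]) auto
  next
    case False
    \<comment> \<open>Otherwise \<open>y - 1\<close> would be an odd cut beyond the largest one, as
      the count stays odd from \<open>k\<close> up to \<open>y - 1\<close>.\<close>
    have "\<exists>x. k < x \<and> x < y \<and> y \<le> w x"
    proof (rule ccontr)
      assume *: "\<not> ?thesis"
      have "\<bar>w i\<bar> \<le> y - 1" if "i \<in> {1..y - 1}" for i
      proof (cases "i \<le> k")
        case True
        then have "\<bar>w i\<bar> \<le> k" using cut that by auto
        then show ?thesis using y1 by simp
      next
        case False
        then show ?thesis using * pos[of i] that by force
      qed
      then have "y - 1 \<in> odd_cuts n w"
        using N[of "y - 1"] k1 y1 by (simp add: odd_cuts_def)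
      then show False using kmax[of "y - 1"] False y1 by simp
    qed
    then obtain x where x: "k < x" "x < y" "y \<le> w x" by blast
    show ?thesis
    proof (rule odd_cuts_reduce[OF w, of 1 x y])
      fix l assume l: "x \<le> l" "l < y"
      have "card {i \<in> {1..l}. (w \<circ> signed_transp 1 x y) i < 0} = Suc (card (?N l))"
        by (rule neg_card_comp[OF w]) (use x y1 k1 l in auto)
      then show "l \<notin> odd_cuts n (w \<circ> signed_transp 1 x y)"
        using N[of l] k1 x l by (simp add: odd_cuts_def)
    qed (use x y1 k1 in auto)
  qed
qed

text \<open>Let \<open>y < z\<close> be the first two positions with negative values. The count is 0
  before \<open>y\<close> and 1 from \<open>y\<close> to \<open>z - 1\<close>. A swap is safe if
  every segment ending in its range gets an even count or contains a value too large for a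
  cut.\<close>

lemma odd_cuts_upper_empty:
  assumes w: "w \<in> signed_perms n" and even_n: "even (card {i \<in> {1..int n}. w i < 0})"
    and empty: "odd_cuts n w = {}" and nid: "w \<noteq> id"
  shows "\<exists>t\<in>transpositions TypeD n. tvd n (w \<circ> t) + 2 * int (card (odd_cuts n (w \<circ> t))) + tvd n t
    \<le> tvd n w + 2 * int (card (odd_cuts n w))"
proof (cases "{i \<in> {1..int n}. w i < 0} = {}")
  case True
  have pos: "0 < w i" if "i \<in> {1..int n}" for i
  proof -
    have "i \<notin> {i \<in> {1..int n}. w i < 0}" unfolding True by simp
    then have "\<not> w i < 0" using that by simp
    then show ?thesis using signed_permsD(2)[OF w, of i] that by auto
  qed
  obtain s a b where ab: "s \<in> {1, - 1}" "0 < a" "a < b" "b \<le> int n" "b \<le> s * w a" "w b \<le> s * a"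
  proof -
    have "\<not> w a \<le> - a" if "0 < a" "a \<le> int n" for a using pos[of a] that by simp
    then have "\<not> (\<exists>a. 0 < a \<and> a \<le> int n \<and> w a \<le> - a)" by blast
    then show thesis using ex_reducing_pair[OF w nid] that by blast
  qed
  have s: "s = 1" using ab pos[of a] by auto
  show ?thesis
  proof (rule odd_cuts_reduce[OF w ab])
    fix l assume l: "a \<le> l" "l < b"
    have "(w \<circ> signed_transp s a b) i > 0" if "i \<in> {1..l}" for i
      using comp_signed_transp_apply[OF w ab(1-3), of i] s pos[of i] pos[of a] pos[of b] that ab l
      by auto
    then have "{i \<in> {1..l}. (w \<circ> signed_transp s a b) i < 0} = {}" by (force simp del: comp_apply)
    then show "l \<notin> odd_cuts n (w \<circ> signed_transp s a b)" by (rule not_odd_cut_no_neg)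
  qed
next
  case False
  let ?N = "\<lambda>k. {i \<in> {1..k}. w i < 0}"
  have fin: "finite (?N (int n))" by (rule finite_subset[of _ "{1..int n}"]) auto
  obtain y where y: "y \<in> ?N (int n)" and ymin: "\<And>x. x \<in> ?N (int n) \<Longrightarrow> y \<le> x"
    using finite_least_element[OF fin False] by blast
  have "?N (int n) - {y} \<noteq> {}"
  proof
    assume "?N (int n) - {y} = {}"
    then have "?N (int n) = {y}" using y by blast
    then show False using even_n by simp
  qed
  then obtain z where z: "z \<in> ?N (int n) - {y}" and zmin: "\<And>x. x \<in> ?N (int n) - {y} \<Longrightarrow> z \<le> x"
    using finite_least_element[of "?N (int n) - {y}"] fin by blast
  have yz: "0 < y" "y < z" "z \<le> int n" "w y < 0" "w z < 0" using y z ymin[of z] by auto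
  have pos: "0 < w i" if "0 < i" "i < z" "i \<noteq> y" for i
  proof -
    have "\<not> w i < 0" using zmin[of i] that yz by auto
    then show ?thesis using signed_permsD(2)[OF w, of i] that by auto
  qed
  have N: "?N l = {y}" if "y \<le> l" "l < z" for l
  proof
    show "?N l \<subseteq> {y}"
    proof
      fix i assume i: "i \<in> ?N l"
      then show "i \<in> {y}" using pos[of i] that by fastforce
    qed
  qed (use that yz in auto)
  \<comment> \<open>After the swap, \<open>w y\<close> sits at \<open>x\<close> and is too large for
    any cut before \<open>y\<close>.\<close>
  have xy: ?thesis if "0 < x" "x < y" "y \<le> w x" "y \<le> \<bar>w y\<bar>" for x
  proof (rule odd_cuts_reduce[OF w, of 1 x y])
    fix l assume l: "x \<le> l" "l < y"
    show "l \<notin> odd_cuts n (w \<circ> signed_transp 1 x y)"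
      by (rule not_odd_cut_witness[of x]) (use that l comp_signed_transp_apply[OF w, of 1 x y x] in auto)
  qed (use that yz in auto)
  \<comment> \<open>From \<open>y\<close> on the count rises from 1 to 2; for segments ending before
    \<open>y\<close> the value \<open>w z\<close>, now at \<open>x\<close>, is too large.\<close>
  have xz: ?thesis if "0 < x" "x < z" "x \<noteq> y" "z \<le> w x" "y < x \<or> y \<le> \<bar>w z\<bar>" for x
  proof (rule odd_cuts_reduce[OF w, of 1 x z])
    fix l assume l: "x \<le> l" "l < z"
    show "l \<notin> odd_cuts n (w \<circ> signed_transp 1 x z)"
    proof (cases "y \<le> l")
      case True
      have "card {i \<in> {1..l}. (w \<circ> signed_transp 1 x z) i < 0} = Suc (card (?N l))"
        by (rule neg_card_comp[OF w]) (use that yz l in auto)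
      then show ?thesis using N[OF True l(2)] by (simp add: odd_cuts_def)
    next
      case False
      then show ?thesis
        by (intro not_odd_cut_witness[of x]) (use that l comp_signed_transp_apply[OF w, of 1 x z x] in auto)
    qed
  qed (use that yz in auto)
  \<comment> \<open>Otherwise \<open>z - 1\<close> is a cut with exactly one sign change.\<close>
  have "\<exists>x. 0 < x \<and> x < z \<and> z \<le> \<bar>w x\<bar>"
  proof (rule ccontr)
    assume *: "\<not> ?thesis"
    have "\<bar>w i\<bar> \<le> z - 1" if "i \<in> {1..z - 1}" for i using * that by force
    then have "z - 1 \<in> odd_cuts n w" using N[of "z - 1"] yz by (simp add: odd_cuts_def)
    then show False using empty by simp
  qed
  then obtain x where x: "0 < x" "x < z" "z \<le> \<bar>w x\<bar>" by blast
  consider "z \<le> \<bar>w y\<bar>" "y \<le> \<bar>w z\<bar>" | "z \<le> \<bar>w y\<bar>" "\<bar>w z\<bar> < y"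
    | "\<bar>w y\<bar> < z" "y < x \<or> y \<le> \<bar>w z\<bar>" | "x < y" "y \<le> \<bar>w y\<bar>"
    | "\<bar>w y\<bar> < y" "\<bar>w z\<bar> < y" "x < y"
  proof -
    have "x = y \<Longrightarrow> z \<le> \<bar>w y\<bar>" using x by simp
    then show thesis using that yz by linarith
  qed
  then show ?thesis
  proof cases
    case 1
    show ?thesis
    \<comment> \<open>The sign-changing swap makes all values before \<open>z\<close>
      positive.\<close>
    proof (rule odd_cuts_reduce[OF w, of "- 1" y z])
      fix l assume l: "y \<le> l" "l < z"
      have "(w \<circ> signed_transp (- 1) y z) i > 0" if "i \<in> {1..l}" for i
        using comp_signed_transp_apply[OF w, of "- 1" y z i] yz pos[of i] that l by auto
      then have "{i \<in> {1..l}. (w \<circ> signed_transp (- 1) y z) i < 0} = {}" by (force simp del: comp_apply)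
      then show "l \<notin> odd_cuts n (w \<circ> signed_transp (- 1) y z)" by (rule not_odd_cut_no_neg)
    qed (use 1 yz in auto)
  next
    case 2
    \<comment> \<open>These are \<open>y\<close> positions, and \<open>z\<close> has a value below
      \<open>y\<close>, so a large value occurs before \<open>y\<close>.\<close>
    have "\<exists>u\<in>{1..y - 1} \<union> {z}. y \<le> \<bar>w u\<bar>"
      by (rule signed_perm_pigeonhole[OF w]) (use yz in auto)
    then obtain u where "u \<in> {1..y - 1}" "y \<le> \<bar>w u\<bar>" using 2 by auto
    then show ?thesis using xy[of u] pos[of u] 2 yz by auto
  next
    case 3
    then show ?thesis using xz[of x] pos[of x] x by force
  next
    case 4
    then show ?thesis using xy[of x] pos[of x] x yz by auto
  next
    case 5
    have wx: "y \<le> w x" using pos[of x] x yz 5 by auto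
    \<comment> \<open>Again \<open>y\<close> positions. Since \<open>y\<close> and \<open>z\<close>
      carry small values, a second large value besides \<open>w x\<close> occurs before
      \<open>y\<close>.\<close>
    let ?S = "({1..y - 1} - {x}) \<union> {y, z}"
    have "card ?S = card ({1..y - 1} - {x}) + card {y, z}"
      by (rule card_Un_disjoint) (use yz in auto)
    also have "\<dots> = card {1..y - 1} - 1 + 2" using x 5 yz by simp
    finally have "int (card ?S) \<ge> y" using yz by simp
    then have "\<exists>u\<in>?S. y \<le> \<bar>w u\<bar>"
      by (intro signed_perm_pigeonhole[OF w]) (use yz in auto)
    then obtain u where uS: "u \<in> ?S" and u: "y \<le> \<bar>w u\<bar>" by blast
    have "u \<noteq> y" "u \<noteq> z" using u 5 by auto
    then have u: "0 < u" "u < y" "u \<noteq> x" "y \<le> \<bar>w u\<bar>" using uS u by auto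
    then have wu: "y \<le> w u" using pos[of u] yz by linarith
    \<comment> \<open>The later of the two large values is swapped with \<open>y\<close>; the
      earlier one stays in place and excludes cuts in the range of the swap.\<close>
    have two: ?thesis if "0 < p" "p < q" "q < y" "y \<le> w p" "y \<le> w q" for p q
    proof (rule odd_cuts_reduce[OF w, of 1 q y])
      fix l assume l: "q \<le> l" "l < y"
      show "l \<notin> odd_cuts n (w \<circ> signed_transp 1 q y)"
        by (rule not_odd_cut_witness[of p]) (use that l comp_signed_transp_apply[OF w, of 1 q y p] in auto)
    qed (use that yz in auto)
    have "u < x \<or> x < u" using u(3) by linarith
    then show ?thesis
      using two[OF u(1) _ 5(3) wu wx] two[OF x(1) _ u(2) wx wu] by blast
  qed
qed

section \<open>The cost formula in the three types\<close>

theorem theorem3p7: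
  fixes n :: nat and X :: ptype and w :: "int \<Rightarrow> int"
  assumes "n \<ge> 1" and "w \<in> perm_group X n"
  shows "cost X n w
    = real_of_int (tvd n w) / 2 + real (blocks TypeB n w) - real (blocks X n w)"
proof -
  have sp: "v \<in> signed_perms n" if "v \<in> perm_group X n" for v
    using that by (cases X) auto
  have lower: "tvd n v \<le> tvd n (v \<circ> t) + tvd n t"
    if "v \<in> perm_group X n" "t \<in> transpositions X n" for v t
  proof -
    have t: "t \<in> signed_perms n" by (rule transposition_signed_perm[OF that(2)])
    have "tvd n (v \<circ> t \<circ> t) \<le> tvd n (v \<circ> t) + tvd n t"
      by (rule tvd_triangle[OF signed_perms_comp[OF sp[OF that(1)] t] t])
    then show ?thesis using transposition_involution[OF that(2)] by (simp add: comp_assoc)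
  qed
  show ?thesis
  proof (cases X)
    case TypeA
    have "cost X n w = real_of_int (tvd n w) / 2"
    proof (rule cost_eqI[OF assms(2)])
      fix v assume v: "v \<in> perm_group X n" "v \<noteq> id"
      have pos: "0 < v i" if "0 < i" "i \<le> int n" for i
        using that v(1) TypeA_iff TypeA by auto
      have "\<not> v a \<le> - a" if "0 < a" "a \<le> int n" for a using pos[OF that] that by simp
      then have "\<not> (\<exists>a. 0 < a \<and> a \<le> int n \<and> v a \<le> - a)" by blast
      then obtain s a b where ab: "s \<in> {1, - 1}" "0 < a" "a < b" "b \<le> int n" "b \<le> s * v a" "v b \<le> s * a"
        using ex_reducing_pair[OF sp[OF v(1)] v(2)] by blast
      \<comment> \<open>The sign \<open>s = - 1\<close> would require \<open>v a \<le> - b\<close>,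
        but the values are positive.\<close>
      have "s = 1" using ab pos[of a] by auto
      then have "signed_transp s a b \<in> transpositions X n"
        using ab TypeA unfolding signed_transp_def by (simp, intro exI[of _ a] exI[of _ b]) simp
      then show "\<exists>t\<in>transpositions X n. tvd n (v \<circ> t) + tvd n t \<le> tvd n v"
        using tvd_reduce[OF sp[OF v(1)] ab] by blast
    qed (rule tvd_id tvd_nonneg lower; assumption)+
    then show ?thesis using blocks_TypeA_eq assms(2) TypeA by simp
  next
    case TypeB
    have "cost X n w = real_of_int (tvd n w) / 2"
    proof (rule cost_eqI[OF assms(2)])
      fix v assume v: "v \<in> perm_group X n" "v \<noteq> id"
      consider a where "0 < a" "a \<le> int n" "v a \<le> - a"
        | s a b where "s \<in> {1, - 1}" "0 < a" "a < b" "b \<le> int n" "b \<le> s * v a" "v b \<le> s * a"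
        using ex_reducing_pair[OF sp[OF v(1)] v(2)] by blast
      then show "\<exists>t\<in>transpositions X n. tvd n (v \<circ> t) + tvd n t \<le> tvd n v"
      proof cases
        case (1 a)
        then have "transpose a (- a) \<in> transpositions X n" using TypeB by auto
        then show ?thesis using tvd_reduce_neg[OF sp[OF v(1)] 1] by blast
      next
        case (2 s a b)
        have "signed_transp s a b \<in> transpositions X n"
          using signed_transp_in[OF 2(1-4)] TypeB by simp
        then show ?thesis using tvd_reduce[OF sp[OF v(1)] 2] by blast
      qed
    qed (rule tvd_id tvd_nonneg lower; assumption)+
    then show ?thesis using TypeB by simp
  next
    case TypeD
    \<comment> \<open>Twice the claimed cost, by \<open>blocks_TypeB_eq\<close>.\<close>
    define G where "G v = tvd n v + 2 * int (card (odd_cuts n v))" for v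
    have "cost X n w = real_of_int (G w) / 2"
    proof (rule cost_eqI[OF assms(2)])
      have "odd_cuts n id = {}"
      proof -
        have "{i \<in> {1..k}. id i < 0} = {}" for k :: int by auto
        then show ?thesis unfolding odd_cuts_def by (simp only: card.empty) simp
      qed
      then show "G id = 0" by (simp add: G_def)
      show "G v \<ge> 0" for v by (simp add: G_def tvd_nonneg)
    next
      fix v t assume v: "v \<in> perm_group X n" "t \<in> transpositions X n"
      then obtain s a b where "s \<in> {1, - 1}" "0 < a" "a < b" "b \<le> int n" "t = signed_transp s a b"
        using transpositions_TypeD_cases TypeD by metis
      then show "G v \<le> G (v \<circ> t) + tvd n t"
        using odd_cuts_lower[OF sp[OF v(1)]] by (simp add: G_def)
    next
      fix v assume v: "v \<in> perm_group X n" "v \<noteq> id"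
      then have "even (card {i \<in> {1..int n}. v i < 0})" using TypeD by (simp add: neg_count_def)
      then show "\<exists>t\<in>transpositions X n. G (v \<circ> t) + tvd n t \<le> G v"
        unfolding G_def TypeD
        using odd_cuts_upper_empty[OF sp[OF v(1)]] odd_cuts_upper_nonempty[OF sp[OF v(1)]] v(2)
        by blast
    qed
    then show ?thesis
      using blocks_TypeB_eq[OF sp[OF assms(2)]] unfolding G_def TypeD by simp
  qed
qed

end
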